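(* Let $\mathbb{A}$ be a unital $C^*$-algebra, let $(X,\mathbb{A},d)$ be a $C^*$-algebra-valued $b$-metric space with coefficient $A\succeq 1_{\mathbb{A}}$, and let $G$ be a directed graph without parallel edges with $V(G)=X$ and $E(G)\supseteq\Delta=\{(x,x):x\in X\}$. Let $f,g:X\to X$ be mappings for which there is $B\in\mathbb{A}'_+$ with $\|BA\|<\frac12$ such that $$d(fx,fy)\preceq B\big(d(fx,gx)+d(fy,gy)\big)\qquad\text{for all }x,y\in X\text{ with }(gx,gy)\in E(\tilde G).$$ Suppose that $f(X)\subseteq g(X)$, that $g(X)$ is a complete subspace of $X$, and that the following property holds: whenever $(gx_n)$ is a sequence (with $x_n\in X$) such that $gx_n\to x$ for some $x\in X$ and $(gx_n,gx_{n+1})\in E(\tilde G)$ for all $n\ge 1$, there is a subsequence $(gx_{n_i})$ with $(gx_{n_i},x)\in E(\tilde G)$ for all $i\ge 1$. If $C_{gf}\neq\emptyset$, then $PC(f,g)\neq\emptyset$. Moreover, if in addition $(x,y)\in E(\tilde G)$ for all $x,y\in PC(f,g)$, then $PC(f,g)$ is a singleton. Furthermore, if in addition $f$ and $g$ are weakly compatible, then $f$ and $g$ have a unique common fixed point in $X$.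
   Context: For a unital $C^*$-algebra $\mathbb{A}$ with unit $1_{\mathbb{A}}$ and zero $0_{\mathbb{A}}$, $\mathbb{A}_+$ is the set of positive elements, and $a\preceq b$ (equivalently $b\succeq a$) means $b-a\in\mathbb{A}_+$. $\mathbb{A}'=\{a\in\mathbb{A}:ab=ba\ \forall b\in\mathbb{A}\}$ and $\mathbb{A}'_+=\mathbb{A}'\cap\mathbb{A}_+$. A $C^*$-algebra-valued $b$-metric space $(X,\mathbb{A},d)$ with coefficient $A$, where $A\in\mathbb{A}_+$ and $A\succeq 1_{\mathbb{A}}$, is a nonempty set $X$ with a map $d:X\times X\to\mathbb{A}_+$ such that for all $x,y,z\in X$: (1) $0_{\mathbb{A}}\preceq d(x,y)$, and $d(x,y)=0_{\mathbb{A}}$ iff $x=y$; (2) $d(x,y)=d(y,x)$; (3) $d(x,y)\preceq A[d(x,z)+d(z,y)]$. A sequence $(x_n)$ converges to $x$ if $\|d(x_n,x)\|\to 0$; it is Cauchy if for every $\epsilon>0$ there is $N$ with $\|d(x_n,x_m)\|\le\epsilon$ for all $n,m\ge N$. A subset of $X$ is a complete subspace if every Cauchy sequence in it converges to a point of it. For a directed graph $G$ without parallel edges, $E(G)\subseteq V(G)\times V(G)$, and $\tilde G$ is the graph with the same vertices and $E(\tilde G)=E(G)\cup\{(x,y):(y,x)\in E(G)\}$. When $f(X)\subseteq g(X)$, starting from any $x_0\in X$ one can construct a sequence $(x_n)_{n\ge0}$ with $gx_n=fx_{n-1}$ for all $n\ge1$. $C_{gf}$ denotes the set of all $x_0\in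 X$ for which there is such a sequence starting at $x_0$ with $(gx_n,gx_m)\in E(\tilde G)$ for all $m,n=0,1,2,\dots$. $PC(f,g)$ is the set of points of coincidence of $f$ and $g$: all $y\in X$ such that $y=fx=gx$ for some $x\in X$. A common fixed point is $x\in X$ with $x=fx=gx$. $f$ and $g$ are weakly compatible if $f(gx)=g(fx)$ whenever $fx=gx$. *)

theory Defs
  imports
    "Graph_Theory.Digraph_Component"
    "HOL-Analysis.Analysis"
begin

section \<open>Unital C*-algebras\<close>

text \<open>
  Complex scalar multiplication extends the real one that comes with
  \<^class>\<open>real_normed_algebra_1\<close>. That class makes the algebra nonzero, with
  \<open>norm 1 = 1\<close>, as is usual for unital Banach algebras.
\<close>

class unital_cstar_algebra = real_normed_algebra_1 + banach +
  fixes scaleC :: "complex \<Rightarrow> 'a \<Rightarrow> 'a"  (infixr "*\<^sub>C" 75)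
    and adj :: "'a \<Rightarrow> 'a"
  assumes scaleC_add_right: "c *\<^sub>C (a + b) = c *\<^sub>C a + c *\<^sub>C b"
    and scaleC_add_left: "(c + c') *\<^sub>C a = c *\<^sub>C a + c' *\<^sub>C a"
    and scaleC_scaleC: "c *\<^sub>C (c' *\<^sub>C a) = (c * c') *\<^sub>C a"
    and scaleC_of_real: "complex_of_real r *\<^sub>C a = r *\<^sub>R a"
    and mult_scaleC_left: "(c *\<^sub>C a) * b = c *\<^sub>C (a * b)"
    and mult_scaleC_right: "a * (c *\<^sub>C b) = c *\<^sub>C (a * b)"
    and norm_scaleC: "norm (c *\<^sub>C a) = cmod c * norm a"
    and adj_adj: "adj (adj a) = a"
    and adj_add: "adj (a + b) = adj a + adj b"
    and adj_scaleC: "adj (c *\<^sub>C a) = cnj c *\<^sub>C adj a"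
    and adj_mult: "adj (a * b) = adj b * adj a"
    and cstar_identity: "norm (adj a * a) = (norm a)\<^sup>2"

instantiation complex :: unital_cstar_algebra
begin

definition scaleC_complex :: "complex \<Rightarrow> complex \<Rightarrow> complex" where
  "scaleC_complex c a = c * a"

definition adj_complex :: "complex \<Rightarrow> complex" where
  "adj_complex = cnj"

instance
  by standard
    (auto simp: scaleC_complex_def adj_complex_def algebra_simps norm_mult power2_eq_square
      scaleR_conv_of_real)

end

definition cstar_spectrum :: "'a::unital_cstar_algebra \<Rightarrow> complex set" where
  "cstar_spectrum a =
     {z. \<not> (\<exists>b. (z *\<^sub>C 1 - a) * b = 1 \<and> b * (z *\<^sub>C 1 - a) = 1)}"

definition cstar_pos :: "'a::unital_cstar_algebra set" where
  "cstar_pos = {a. adj a = a \<and> cstar_spectrum a \<subseteq> \<real>\<^sub>\<ge>\<^sub>0}"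

definition cstar_le :: "'a::unital_cstar_algebra \<Rightarrow> 'a \<Rightarrow> bool"  (infix "\<preceq>" 50) where
  "a \<preceq> b \<longleftrightarrow> b - a \<in> cstar_pos"

definition cstar_center :: "'a::unital_cstar_algebra set" where
  "cstar_center = {a. \<forall>b. a * b = b * a}"

definition cstar_center_pos :: "'a::unital_cstar_algebra set" where
  "cstar_center_pos = cstar_center \<inter> cstar_pos"


section \<open>C*-algebra-valued b-metric spaces\<close>

locale cstar_b_metric_space =
  fixes X :: "'x set"
    and d :: "'x \<Rightarrow> 'x \<Rightarrow> 'a::unital_cstar_algebra"
    and A :: 'a
  assumes coeff_pos: "A \<in> cstar_pos"
    and coeff_ge_1: "1 \<preceq> A"
    and nonempty: "X \<noteq> {}"
    and d_pos: "x \<in> X \<Longrightarrow> y \<in> X \<Longrightarrow> 0 \<preceq> d x y"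
    and d_eq_0_iff: "x \<in> X \<Longrightarrow> y \<in> X \<Longrightarrow> d x y = 0 \<longleftrightarrow> x = y"
    and d_sym: "x \<in> X \<Longrightarrow> y \<in> X \<Longrightarrow> d x y = d y x"
    and d_triangle: "x \<in> X \<Longrightarrow> y \<in> X \<Longrightarrow> z \<in> X \<Longrightarrow> d x y \<preceq> A * (d x z + d z y)"

definition converges_to ::
    "('x \<Rightarrow> 'x \<Rightarrow> 'a::unital_cstar_algebra) \<Rightarrow> (nat \<Rightarrow> 'x) \<Rightarrow> 'x \<Rightarrow> bool" where
  "converges_to d s x \<longleftrightarrow> (\<lambda>n. norm (d (s n) x)) \<longlonglongrightarrow> 0"

definition cauchy_seq ::
    "('x \<Rightarrow> 'x \<Rightarrow> 'a::unital_cstar_algebra) \<Rightarrow> (nat \<Rightarrow> 'x) \<Rightarrow> bool" where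
  "cauchy_seq d s \<longleftrightarrow> (\<forall>e>0. \<exists>N. \<forall>n\<ge>N. \<forall>m\<ge>N. norm (d (s n) (s m)) \<le> e)"

definition complete_subspace ::
    "'x set \<Rightarrow> ('x \<Rightarrow> 'x \<Rightarrow> 'a::unital_cstar_algebra) \<Rightarrow> 'x set \<Rightarrow> bool" where
  "complete_subspace X d S \<longleftrightarrow>
     S \<subseteq> X \<and> (\<forall>s. (\<forall>n. s n \<in> S) \<and> cauchy_seq d s \<longrightarrow> (\<exists>x\<in>S. converges_to d s x))"


section \<open>Graphs and pairs of maps\<close>

text \<open>
  \<^typ>\<open>'x pair_pre_digraph\<close> represents arcs as pairs of vertices, so there are no parallel
  arcs, while loops are allowed.
\<close>

definition sym_edges :: "'x pair_pre_digraph \<Rightarrow> ('x \<times> 'x) set" where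
  "sym_edges G = parcs (mk_symmetric (with_proj G))"

lemma sym_edges_eq: "sym_edges G = parcs G \<union> {(x, y). (y, x) \<in> parcs G}"
  by (auto simp: sym_edges_def parcs_mk_symmetric)

definition C_set ::
    "'x set \<Rightarrow> 'x pair_pre_digraph \<Rightarrow> ('x \<Rightarrow> 'x) \<Rightarrow> ('x \<Rightarrow> 'x) \<Rightarrow> 'x set" where
  "C_set X G g f =
     {x0 \<in> X. \<exists>s :: nat \<Rightarrow> 'x. s 0 = x0 \<and> (\<forall>n. s n \<in> X) \<and> (\<forall>n\<ge>1. g (s n) = f (s (n - 1))) \<and>
        (\<forall>n m. (g (s n), g (s m)) \<in> sym_edges G)}"

definition PC :: "'x set \<Rightarrow> ('x \<Rightarrow> 'x) \<Rightarrow> ('x \<Rightarrow> 'x) \<Rightarrow> 'x set" where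
  "PC X f g = {y \<in> X. \<exists>x\<in>X. y = f x \<and> y = g x}"

definition common_fixed_point :: "'x set \<Rightarrow> ('x \<Rightarrow> 'x) \<Rightarrow> ('x \<Rightarrow> 'x) \<Rightarrow> 'x \<Rightarrow> bool" where
  "common_fixed_point X f g x \<longleftrightarrow> x \<in> X \<and> x = f x \<and> x = g x"

definition weakly_compatible :: "'x set \<Rightarrow> ('x \<Rightarrow> 'x) \<Rightarrow> ('x \<Rightarrow> 'x) \<Rightarrow> bool" where
  "weakly_compatible X f g \<longleftrightarrow> (\<forall>x\<in>X. f x = g x \<longrightarrow> f (g x) = g (f x))"

end

theory Submission
  imports Defs
begin

text \<open>
  Put \<open>D x = norm (d (f x) (g x))\<close> and \<open>k = norm B\<close>. The norm is monotone on positive elements,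
  so the contraction gives the scalar bound \<open>norm (d (f x) (f y)) \<le> k * (D x + D y)\<close>,
  where \<open>k \<le> norm (B * A) < 1 / 2\<close>. Along the iteration \<open>D\<close> decays geometrically with ratio
  \<open>k / (1 - k)\<close>, and the scalar bound then makes the sequence Cauchy without any use of the
  triangle inequality. That inequality is needed only to see that the limit \<open>g t\<close> satisfies \<open>f t = g t\<close>.
  There the factor \<open>norm (B * A)\<close>, rather than \<open>norm B * norm A\<close>, is obtained because the axioms
  force \<open>A\<close> to commute with all distances, and a product of commuting positive elements is positive.
\<close>

section \<open>Inverses in Banach algebras\<close>

definition invertible_el :: "'a::monoid_mult \<Rightarrow> bool" where
  "invertible_el x \<longleftrightarrow> (\<exists>y. x * y = 1 \<and> y * x = 1)"

definition minv :: "'a::monoid_mult \<Rightarrow> 'a" where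
  "minv x = (SOME y. x * y = 1 \<and> y * x = 1)"

lemma minv:
  assumes "invertible_el x"
  shows minv_right: "x * minv x = 1" and minv_left: "minv x * x = 1"
  using assms someI_ex[of "\<lambda>y. x * y = 1 \<and> y * x = 1"]
  unfolding invertible_el_def minv_def by auto

lemma invertible_elI: "x * y = 1 \<Longrightarrow> y * x = 1 \<Longrightarrow> invertible_el x"
  by (auto simp: invertible_el_def)

lemma minv_eqI:
  assumes "x * y = 1" "y * x = 1"
  shows "minv x = y"
proof -
  have "minv x = minv x * (x * y)" using assms by simp
  also have "\<dots> = y"
    using minv_left[OF invertible_elI[OF assms]] by (simp flip: mult.assoc)
  finally show ?thesis .
qed

lemma invertible_el_mult:
  assumes "invertible_el x" "invertible_el y"
  shows "invertible_el (x * y)"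
proof (rule invertible_elI)
  show "x * y * (minv y * minv x) = 1"
    by (metis assms minv_right mult.assoc mult_1_right)
  show "minv y * minv x * (x * y) = 1"
    by (metis assms minv_left mult.assoc mult_1_right)
qed

lemma invertible_el_minus:
  fixes x :: "'a::ring_1"
  assumes "invertible_el x"
  shows "invertible_el (- x)"
  using minv[OF assms] by (intro invertible_elI[of _ "- minv x"]) auto

text \<open>Neumann series: removing the first term from the sum \<open>y\<close> of the powers
  leaves \<open>y - 1\<close>, which equals both \<open>x * y\<close> and
  \<open>y * x\<close>.\<close>

lemma invertible_el_1_minus:
  fixes x :: "'a::{real_normed_algebra_1, banach}"
  assumes "norm x < 1"
  shows "invertible_el (1 - x)"
proof -
  have s: "summable (\<lambda>n. x ^ n)"
    using assms by (rule complete_algebra_summable_geometric)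
  define y where "y = (\<Sum>n. x ^ n)"
  have "(\<Sum>n. x ^ Suc n) = y - 1"
    unfolding y_def by (subst suminf_split_head[OF s]) simp
  moreover have "(\<Sum>n. x ^ Suc n) = x * y"
    unfolding y_def by (simp add: suminf_mult[OF s])
  moreover have "(\<Sum>n. x ^ Suc n) = y * x"
    unfolding y_def by (subst suminf_mult2[OF s]) (simp add: power_commutes)
  ultimately show ?thesis
    by (intro invertible_elI[of _ y]) (auto simp: algebra_simps)
qed

text \<open>The inverse \<open>y\<close> satisfies \<open>y - 1 = x * (y - 1) + x\<close>; taking
  norms and solving for \<open>norm (y - 1)\<close> gives the bound.\<close>

lemma norm_minv_1_minus:
  fixes x :: "'a::real_normed_algebra_1"
  assumes "invertible_el (1 - x)" "norm x < 1"
  shows "norm (minv (1 - x) - 1) \<le> norm x / (1 - norm x)"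
proof -
  define y where "y = minv (1 - x)"
  have "y - 1 = x * (y - 1) + x"
    using minv_right[OF assms(1)] by (simp add: y_def algebra_simps)
  then have "norm (y - 1) \<le> norm x * norm (y - 1) + norm x"
    by (metis norm_triangle_le add_right_mono norm_mult_ineq)
  then show ?thesis
    using assms(2) by (simp add: y_def field_simps)
qed

text \<open>Partial fractions. This passes from resolvents of an element to those of its
  square.\<close>

lemma minv_diff_squares:
  fixes x :: "'a::real_algebra_1"
  assumes "invertible_el (1 - x)" "invertible_el (1 + x)"
  shows "invertible_el (1 - x * x)"
    and "minv (1 - x * x) = (1 / 2) *\<^sub>R (minv (1 - x) + minv (1 + x))"
proof -
  let ?p = "minv (1 - x)" and ?q = "minv (1 + x)"
  have f: "1 - x * x = (1 + x) * (1 - x)" "1 - x * x = (1 - x) * (1 + x)"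
    by (auto simp: algebra_simps)
  have "(1 - x * x) * (?p + ?q) = (1 + x) * ((1 - x) * ?p) + (1 - x) * ((1 + x) * ?q)"
    by (subst distrib_left, subst f(1), subst f(2), simp only: mult.assoc)
  also have "\<dots> = 2 *\<^sub>R 1"
    using assms by (simp add: minv_right scaleR_2)
  finally have r: "(1 - x * x) * ((1 / 2) *\<^sub>R (?p + ?q)) = 1" by simp
  have "(?p + ?q) * (1 - x * x) = (?p * (1 - x)) * (1 + x) + (?q * (1 + x)) * (1 - x)"
    by (subst distrib_right, subst f(2), subst f(1), simp only: mult.assoc)
  also have "\<dots> = 2 *\<^sub>R 1"
    using assms by (simp add: minv_left scaleR_2)
  finally have l: "((1 / 2) *\<^sub>R (?p + ?q)) * (1 - x * x) = 1" by simp
  show "invertible_el (1 - x * x)" "minv (1 - x * x) = (1 / 2) *\<^sub>R (?p + ?q)"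
    using invertible_elI[OF r l] minv_eqI[OF r l] by auto
qed

section \<open>The spectrum of a self-adjoint element\<close>

lemma scaleC_simps [simp]:
  fixes a :: "'a::unital_cstar_algebra"
  shows "1 *\<^sub>C a = a" "0 *\<^sub>C a = 0" "c *\<^sub>C (0::'a) = 0"
    "(- c) *\<^sub>C a = - (c *\<^sub>C a)" "c *\<^sub>C (- a) = - (c *\<^sub>C a)"
proof -
  show "1 *\<^sub>C a = a" "0 *\<^sub>C a = 0"
    using scaleC_of_real[of 1 a] scaleC_of_real[of 0 a] by auto
  show "c *\<^sub>C (0::'a) = 0"
    using scaleC_add_right[of c "0::'a" 0] by simp
  show "(- c) *\<^sub>C a = - (c *\<^sub>C a)"
    using scaleC_add_left[of c "-c" a] \<open>0 *\<^sub>C a = 0\<close>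
    by (metis add.right_inverse minus_unique)
  show "c *\<^sub>C (- a) = - (c *\<^sub>C a)"
    using scaleC_add_right[of c a "-a"] \<open>c *\<^sub>C (0::'a) = 0\<close>
    by (metis add.right_inverse minus_unique)
qed

lemma scaleC_diff:
  fixes a :: "'a::unital_cstar_algebra"
  shows "(c - c') *\<^sub>C a = c *\<^sub>C a - c' *\<^sub>C a" "c *\<^sub>C (a - b) = c *\<^sub>C a - c *\<^sub>C b"
  using scaleC_add_left[of c "-c'" a] scaleC_add_right[of c a "-b"] by auto

lemma scaleC_of_real_1: "complex_of_real t *\<^sub>C (1::'a::unital_cstar_algebra) = of_real t"
  unfolding scaleC_of_real by (simp add: of_real_def)

lemma adj_minus: "adj (- a) = - adj (a::'a::unital_cstar_algebra)"
  using adj_scaleC[of "-1" a] by simp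

lemma adj_diff: "adj (a - b) = adj a - adj (b::'a::unital_cstar_algebra)"
  using adj_add[of a "-b"] by (simp add: adj_minus)

lemma adj_scaleR: "adj (r *\<^sub>R a) = r *\<^sub>R adj (a::'a::unital_cstar_algebra)"
  using adj_scaleC[of "of_real r" a] by (simp add: scaleC_of_real)

lemma adj_1 [simp]: "adj (1::'a::unital_cstar_algebra) = 1"
  by (metis adj_adj adj_mult mult_1_right mult_1_left)

lemma adj_of_real [simp]: "adj (of_real r :: 'a::unital_cstar_algebra) = of_real r"
  by (simp add: of_real_def adj_scaleR)

lemma adj_power: "adj (a ^ n) = adj (a::'a::unital_cstar_algebra) ^ n"
  by (induction n) (simp_all add: adj_mult power_commutes)

lemma norm_adj [simp]: "norm (adj a) = norm (a::'a::unital_cstar_algebra)"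
proof -
  have "norm b \<le> norm (adj b)" for b :: 'a
  proof (cases "b = 0")
    case False
    have "norm b * norm b \<le> norm (adj b) * norm b"
      using norm_mult_ineq[of "adj b" b] by (simp add: cstar_identity power2_eq_square)
    then show ?thesis using False by simp
  qed simp
  from this[of a] this[of "adj a"] show ?thesis by (simp add: adj_adj)
qed

lemma bounded_linear_adj: "bounded_linear (adj :: 'a::unital_cstar_algebra \<Rightarrow> 'a)"
  by (rule bounded_linear_intro[where K = 1]) (auto simp: adj_add adj_scaleR)

text \<open>For self-adjoint elements the C*-identity says that squaring the element squares its
  norm; iterating it reaches the exponents that are powers of two.\<close>

lemma norm_selfadjoint_power:
  fixes a :: "'a::unital_cstar_algebra"
  assumes "adj a = a"
  shows "norm (a ^ 2 ^ k) = norm a ^ 2 ^ k"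
proof (induction k)
  case (Suc k)
  have "norm (a ^ 2 ^ Suc k) = norm (adj (a ^ 2 ^ k) * a ^ 2 ^ k)"
    using assms by (simp add: adj_power power_add mult_2)
  also have "\<dots> = (norm a ^ 2 ^ k)\<^sup>2"
    by (simp only: cstar_identity Suc.IH)
  finally show ?case by (metis power_Suc2 power_mult)
qed simp

section \<open>Spectral values and the norm\<close>

lemma cstar_spectrum_iff: "z \<in> cstar_spectrum a \<longleftrightarrow> \<not> invertible_el (z *\<^sub>C 1 - a)"
  by (simp add: cstar_spectrum_def invertible_el_def)

lemma invertible_el_scaleC:
  fixes x :: "'a::unital_cstar_algebra"
  assumes "invertible_el x" "c \<noteq> 0"
  shows "invertible_el (c *\<^sub>C x)"
  using minv[OF assms(1)] assms(2)
  by (intro invertible_elI[of _ "inverse c *\<^sub>C minv x"])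
    (simp_all add: mult_scaleC_left mult_scaleC_right scaleC_scaleC)

text \<open>Outside the norm ball, z - a = z (1 - a / z), and the second factor is inverted by the
  Neumann series.\<close>

lemma cstar_spectrum_norm:
  assumes "z \<in> cstar_spectrum a"
  shows "cmod z \<le> norm a"
proof (rule ccontr)
  assume *: "\<not> cmod z \<le> norm a"
  then have "z \<noteq> 0" by auto
  moreover have "norm (inverse z *\<^sub>C a) < 1"
  proof -
    have "norm (inverse z *\<^sub>C a) = norm a / cmod z"
      by (simp add: norm_scaleC norm_inverse divide_inverse mult.commute)
    then show ?thesis using * \<open>z \<noteq> 0\<close> by simp
  qed
  ultimately have "invertible_el (z *\<^sub>C (1 - inverse z *\<^sub>C a))"
    using invertible_el_1_minus invertible_el_scaleC by blast
  with \<open>z \<noteq> 0\<close> assms show False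
    by (simp add: cstar_spectrum_iff scaleC_diff scaleC_scaleC)
qed

lemma cstar_spectrum_of_real_minus:
  "z \<in> cstar_spectrum (of_real t - a) \<longleftrightarrow> of_real t - z \<in> cstar_spectrum a"
proof -
  have "(of_real t - z) *\<^sub>C 1 - a = - (z *\<^sub>C 1 - (of_real t - a))"
    by (simp add: scaleC_diff scaleC_of_real_1)
  then show ?thesis
    using invertible_el_minus by (metis cstar_spectrum_iff minus_minus)
qed

text \<open>Arens' trick: shifting by \<open>\<i> t\<close> moves a nonreal spectral value out of the
  norm ball as \<open>t\<close> grows.\<close>

lemma cstar_spectrum_selfadjoint_real:
  fixes a :: "'a::unital_cstar_algebra"
  assumes a: "adj a = a" and z: "z \<in> cstar_spectrum a"
  shows "Im z = 0"
proof -
  have bound: "(cmod z)\<^sup>2 + 2 * Im z * t \<le> (norm a)\<^sup>2" for t :: real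
  proof -
    let ?c = "\<i> * of_real t" and ?b = "a + (\<i> * of_real t) *\<^sub>C 1"
    have "z + ?c \<in> cstar_spectrum ?b"
      using z by (simp add: cstar_spectrum_iff scaleC_add_left)
    then have "(cmod (z + ?c))\<^sup>2 \<le> (norm ?b)\<^sup>2"
      by (intro power_mono cstar_spectrum_norm) auto
    also have "\<dots> = norm (adj ?b * ?b)" by (simp add: cstar_identity)
    also have "adj ?b * ?b = (a - ?c *\<^sub>C 1) * ?b"
      by (simp add: adj_add adj_scaleC a)
    also have "\<dots> = a * a - (?c * ?c) *\<^sub>C 1"
      by (simp add: distrib_left left_diff_distrib mult_scaleC_left
          mult_scaleC_right scaleC_scaleC scaleC_diff(2))
    also have "?c * ?c = - complex_of_real (t\<^sup>2)"
      by (simp add: complex_eq_iff power2_eq_square)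
    also have "a * a - (- complex_of_real (t\<^sup>2)) *\<^sub>C 1 = a * a + of_real (t\<^sup>2)"
      by (simp only: scaleC_simps scaleC_of_real_1 diff_minus_eq_add)
    also have "norm \<dots> \<le> norm (a * a) + norm (of_real (t\<^sup>2) :: 'a)"
      by (rule norm_triangle_ineq)
    also have "\<dots> \<le> (norm a)\<^sup>2 + t\<^sup>2"
      using norm_mult_ineq[of a a] unfolding norm_of_real by (simp add: power2_eq_square)
    finally have "(cmod (z + ?c))\<^sup>2 \<le> (norm a)\<^sup>2 + t\<^sup>2" .
    moreover have "(cmod (z + ?c))\<^sup>2 = (cmod z)\<^sup>2 + 2 * Im z * t + t\<^sup>2"
      unfolding cmod_power2 by (simp add: power2_eq_square algebra_simps)
    ultimately show ?thesis by simp
  qed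
  show ?thesis
  proof (rule ccontr)
    assume "Im z \<noteq> 0"
    \<comment> \<open>The value of \<open>t\<close> is chosen so that the linear term alone already
      exceeds \<open>(norm a)\<^sup>2\<close>.\<close>
    then have "2 * Im z * (((norm a)\<^sup>2 + 1) / (2 * Im z)) = (norm a)\<^sup>2 + 1" by simp
    with bound[of "((norm a)\<^sup>2 + 1) / (2 * Im z)"] zero_le_power2[of "cmod z"]
    show False by linarith
  qed
qed

section \<open>Resolvents and the spectral radius of self-adjoint elements\<close>

lemma continuous_on_minv_1_minus_scaleC:
  fixes b :: "'a::unital_cstar_algebra"
  assumes inv: "\<And>\<mu>. \<mu> \<in> S \<Longrightarrow> invertible_el (1 - \<mu> *\<^sub>C b)" and b: "norm b \<le> 1"
  shows "continuous_on S (\<lambda>\<mu>. minv (1 - \<mu> *\<^sub>C b))"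
  unfolding continuous_on_def
proof
  fix \<mu> assume \<mu>: "\<mu> \<in> S"
  define f where "f \<nu> = minv (1 - \<nu> *\<^sub>C b)" for \<nu>
  define M where "M = norm (f \<mu>)"
  have res: "norm (f \<nu> - f \<mu>) \<le> cmod (\<nu> - \<mu>) * norm (f \<nu>) * M" if "\<nu> \<in> S" for \<nu>
  proof -
    \<comment> \<open>The resolvent identity: a factor 1 is inserted into each term, after which
      only the difference of the parameters survives.\<close>
    have "f \<nu> - f \<mu> = f \<nu> * ((1 - \<mu> *\<^sub>C b) * f \<mu>) - (f \<nu> * (1 - \<nu> *\<^sub>C b)) * f \<mu>"
      using inv[OF \<mu>] inv[OF that] by (simp add: f_def minv_left minv_right)
    also have "\<dots> = (\<nu> - \<mu>) *\<^sub>C (f \<nu> * b * f \<mu>)"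
      by (simp add: algebra_simps mult_scaleC_left mult_scaleC_right scaleC_diff)
    finally have "norm (f \<nu> - f \<mu>) = cmod (\<nu> - \<mu>) * norm (f \<nu> * b * f \<mu>)"
      by (simp add: norm_scaleC)
    also have "norm (f \<nu> * b * f \<mu>) \<le> norm (f \<nu>) * norm b * norm (f \<mu>)"
      by (meson mult_right_mono norm_ge_zero norm_mult_ineq order_trans)
    also have "\<dots> \<le> norm (f \<nu>) * 1 * norm (f \<mu>)"
      using b by (intro mult_right_mono mult_left_mono) auto
    finally show ?thesis by (simp add: M_def mult_left_mono mult.assoc)
  qed
  \<comment> \<open>Once \<open>cmod (\<nu> - \<mu>) * M < 1 / 2\<close>, the estimate
    \<open>res\<close> forces \<open>norm (f \<nu>) \<le> 2 * M\<close>; substituting this back into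
    \<open>res\<close> gives a Lipschitz bound.\<close>
  have "\<forall>\<^sub>F \<nu> in at \<mu> within S. norm (f \<nu> - f \<mu>) \<le> 2 * M\<^sup>2 * cmod (\<nu> - \<mu>)"
  proof -
    have t: "((\<lambda>\<nu>. cmod (\<nu> - \<mu>) * M) \<longlongrightarrow> cmod (\<mu> - \<mu>) * M) (at \<mu> within S)"
      by (intro tendsto_intros)
    then have "\<forall>\<^sub>F \<nu> in at \<mu> within S. cmod (\<nu> - \<mu>) * M < 1 / 2"
      by (rule order_tendstoD(2)) simp
    moreover have "\<forall>\<^sub>F \<nu> in at \<mu> within S. \<nu> \<in> S"
      by (simp add: eventually_at_filter)
    ultimately show ?thesis
    proof eventually_elim
      case (elim \<nu>)
      have n: "norm (f \<nu>) \<le> M + norm (f \<nu> - f \<mu>)"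
        using norm_triangle_sub[of "f \<nu>" "f \<mu>"] by (simp add: M_def)
      have "norm (f \<nu> - f \<mu>) \<le> (cmod (\<nu> - \<mu>) * M) * norm (f \<nu>)"
        using res[OF elim(2)] by (simp add: mult_ac)
      also have "\<dots> \<le> (1 / 2) * norm (f \<nu>)"
        using elim by (intro mult_right_mono) auto
      finally have "norm (f \<nu>) \<le> 2 * M" using n by simp
      then have "cmod (\<nu> - \<mu>) * norm (f \<nu>) * M \<le> cmod (\<nu> - \<mu>) * (2 * M) * M"
        by (intro mult_right_mono mult_left_mono) (auto simp: M_def)
      with res[OF elim(2)] show ?case by (simp add: power2_eq_square mult_ac)
    qed
  qed
  moreover have "((\<lambda>\<nu>. 2 * M\<^sup>2 * cmod (\<nu> - \<mu>)) \<longlongrightarrow> 0) (at \<mu> within S)"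
    by (auto intro!: tendsto_eq_intros)
  ultimately have "((\<lambda>\<nu>. f \<nu> - f \<mu>) \<longlongrightarrow> 0) (at \<mu> within S)"
    by (rule Lim_null_comparison)
  then show "((\<lambda>\<nu>. minv (1 - \<nu> *\<^sub>C b)) \<longlongrightarrow> minv (1 - \<mu> *\<^sub>C b)) (at \<mu> within S)"
    using LIM_zero_cancel by (auto simp: f_def)
qed

text \<open>An elementary substitute for the spectral radius formula. By uniform continuity on the disc,
  the resolvent at \<open>\<mu>\<close> on the circle is close to that at \<open>s \<mu>\<close> for some \<open>s < 1\<close>. Averaging
  over \<open>\<mu>\<close> and \<open>- \<mu>\<close> carries this estimate from \<open>b\<close> to \<open>b\<^sup>2\<close>, with \<open>s\<^sup>2\<close> in place of
  \<open>s\<close>, while the resolvent of \<open>b ^ 2 ^ k\<close> at \<open>s ^ 2 ^ k\<close> tends to 1.\<close>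

lemma exists_power_norm_less_1:
  fixes b :: "'a::unital_cstar_algebra"
  assumes inv: "\<And>\<mu>. cmod \<mu> \<le> 1 \<Longrightarrow> invertible_el (1 - \<mu> *\<^sub>C b)" and b: "norm b \<le> 1"
  shows "\<exists>k. norm (b ^ 2 ^ k) < 1"
proof -
  define F where "F k \<mu> = minv (1 - \<mu> *\<^sub>C b ^ 2 ^ k)" for k :: nat and \<mu>
  have sq: "1 - (\<nu> * \<nu>) *\<^sub>C b ^ 2 ^ Suc k = 1 - (\<nu> *\<^sub>C b ^ 2 ^ k) * (\<nu> *\<^sub>C b ^ 2 ^ k)" for k \<nu>
    by (simp add: mult_scaleC_left mult_scaleC_right scaleC_scaleC mult_2 power_add)
  have invk: "invertible_el (1 - \<mu> *\<^sub>C b ^ 2 ^ k)" if "cmod \<mu> \<le> 1" for k \<mu>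
    using that
  proof (induction k arbitrary: \<mu>)
    case (Suc k)
    \<comment> \<open>Both square roots of a point of the disc lie in the disc, so invertibility at
      level \<open>k\<close> for \<open>\<nu>\<close> and \<open>- \<nu>\<close> yields level
      \<open>Suc k\<close>.\<close>
    define \<nu> where "\<nu> = csqrt \<mu>"
    have \<nu>: "\<mu> = \<nu> * \<nu>" "cmod \<nu> \<le> 1"
      using Suc.prems by (auto simp: \<nu>_def norm_csqrt simp flip: power2_eq_square)
    show ?case
      unfolding \<nu>(1) sq using Suc.IH[of \<nu>] Suc.IH[of "- \<nu>"] \<nu>(2)
      by (intro minv_diff_squares) auto
  qed (use inv in simp)
  have F_sq: "F (Suc k) (\<nu> * \<nu>) = (1 / 2) *\<^sub>R (F k \<nu> + F k (- \<nu>))" if "cmod \<nu> \<le> 1" for k \<nu>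
    unfolding F_def sq using invk[of \<nu> k] invk[of "- \<nu>" k] that
    by (subst minv_diff_squares) auto
  have "uniformly_continuous_on (cball 0 1) (F 0)"
    unfolding F_def using inv b
    by (intro compact_uniformly_continuous continuous_on_minv_1_minus_scaleC) auto
  then obtain \<delta> where "\<delta> > 0" and
    \<delta>: "\<And>\<mu> \<nu>. cmod \<mu> \<le> 1 \<Longrightarrow> cmod \<nu> \<le> 1 \<Longrightarrow> cmod (\<nu> - \<mu>) < \<delta> \<Longrightarrow> norm (F 0 \<nu> - F 0 \<mu>) < 1 / 8"
    unfolding uniformly_continuous_on_def dist_norm
    by (metis mem_cball_0 zero_less_divide_1_iff zero_less_numeral)
  \<comment> \<open>Truncating at 0 keeps \<open>s\<close> nonnegative when \<open>\<delta>\<close>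
    is large, and \<open>s\<close> stays within \<open>\<delta>\<close> of 1 in every case.\<close>
  define s where "s = max 0 (1 - \<delta> / 2)"
  have s: "0 \<le> s" "s < 1" "\<bar>s - 1\<bar> < \<delta>"
    using \<open>\<delta> > 0\<close> by (auto simp: s_def)
  have close: "norm (F k (of_real (s ^ 2 ^ k) * \<mu>) - F k \<mu>) \<le> 1 / 8" if "cmod \<mu> = 1" for k \<mu>
    using that
  proof (induction k arbitrary: \<mu>)
    case 0
    have "cmod (of_real s * \<mu> - \<mu>) = \<bar>s - 1\<bar>"
      using 0 norm_mult[of "of_real (s - 1)" \<mu>]
      by (simp add: algebra_simps flip: norm_of_real[where 'a = complex])
    then show ?case
      using 0 s by (intro less_imp_le[OF \<delta>]) (auto simp: norm_mult)
  next
    case (Suc k)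
    define \<nu> where "\<nu> = csqrt \<mu>"
    define t where "t = complex_of_real (s ^ 2 ^ k)"
    have \<nu>: "\<mu> = \<nu> * \<nu>" "cmod \<nu> = 1"
      using Suc.prems by (auto simp: \<nu>_def norm_csqrt simp flip: power2_eq_square)
    have t: "of_real (s ^ 2 ^ Suc k) * \<mu> = (t * \<nu>) * (t * \<nu>)"
    proof -
      have "s ^ 2 ^ Suc k = s ^ 2 ^ k * s ^ 2 ^ k"
        by (simp add: mult_2 power_add)
      then show ?thesis
        by (simp only: t_def \<nu>(1) of_real_mult mult_ac)
    qed
    have t1: "cmod (t * \<nu>) \<le> 1"
      using s \<nu>(2) by (simp add: t_def norm_mult norm_power power_le_one)
    \<comment> \<open>The new error is the average of two old ones, so the bound 1/8 does not grow
      with \<open>k\<close>.\<close>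
    have "F (Suc k) ((t * \<nu>) * (t * \<nu>)) - F (Suc k) (\<nu> * \<nu>) =
        (1 / 2) *\<^sub>R ((F k (t * \<nu>) - F k \<nu>) + (F k (t * - \<nu>) - F k (- \<nu>)))"
      using \<nu>(2) by (simp add: F_sq[OF t1] F_sq[of \<nu>] scaleR_add_right scaleR_diff_right)
    moreover have "norm (F k (t * \<nu>) - F k \<nu>) \<le> 1 / 8" "norm (F k (t * - \<nu>) - F k (- \<nu>)) \<le> 1 / 8"
      unfolding t_def using \<nu>(2) by (intro Suc.IH; simp)+
    ultimately show ?case
      unfolding t unfolding \<nu>(1)
      using norm_triangle_ineq[of "F k (t * \<nu>) - F k \<nu>" "F k (t * - \<nu>) - F k (- \<nu>)"] by simp
  qed
  have "(\<lambda>n. s ^ n) \<longlonglongrightarrow> 0"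
    using s by (intro LIMSEQ_power_zero) auto
  then have "\<forall>\<^sub>F n in sequentially. s ^ n < 1 / 5"
    by (rule order_tendstoD(2)) simp
  \<comment> \<open>The threshold 1/5 turns the Neumann estimate into 1/4; adding the 1/8 from
    \<open>close\<close> gives the 3/8 below.\<close>
  then obtain k where "\<And>n. n \<ge> k \<Longrightarrow> s ^ n < 1 / 5"
    unfolding eventually_sequentially by blast
  then have k: "s ^ 2 ^ k < 1 / 5"
    using less_exp[of k] by (simp add: less_imp_le)
  define c where "c = b ^ 2 ^ k"
  define x where "x = complex_of_real (s ^ 2 ^ k) *\<^sub>C c"
  have "norm c \<le> 1"
    unfolding c_def using b power_le_one[of "norm b"] norm_power_ineq[of b] order_trans by fastforce
  then have x: "norm x \<le> 1 / 5"
    using k s mult_mono[of "s ^ 2 ^ k" "1 / 5" "norm c" 1]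
    by (simp add: x_def norm_scaleC norm_power)
  have "norm (F k (of_real (s ^ 2 ^ k)) - 1) \<le> norm x / (1 - norm x)"
    unfolding F_def c_def[symmetric] x_def[symmetric]
    by (rule norm_minv_1_minus) (use x in \<open>auto intro: invertible_el_1_minus\<close>)
  also have "\<dots> \<le> 1 / 4"
    using x by (simp add: field_simps)
  finally have F1: "norm (F k 1 - 1) \<le> 3 / 8"
    using close[of 1 k] norm_triangle_sub[of "F k 1 - 1" "F k (of_real (s ^ 2 ^ k)) - 1"]
    by (simp add: norm_minus_commute)
  have "(1 - c) * F k 1 = 1"
    using minv_right[OF invk[of 1 k]] by (simp add: F_def c_def)
  \<comment> \<open>Writing \<open>c\<close> in terms of \<open>F k 1 - 1\<close> gives norm c \<le>
    3/8 (1 + norm c), hence norm c \<le> 3/5.\<close>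
  then have "c = (F k 1 - 1) - c * (F k 1 - 1)"
    by (simp add: algebra_simps)
  then have "norm c = norm ((F k 1 - 1) - c * (F k 1 - 1))"
    by (rule arg_cong)
  also have "\<dots> \<le> norm (F k 1 - 1) + norm (c * (F k 1 - 1))"
    by (rule norm_triangle_ineq4)
  also have "\<dots> \<le> norm (F k 1 - 1) + norm c * norm (F k 1 - 1)"
    by (intro add_left_mono norm_mult_ineq)
  also have "\<dots> \<le> 3 / 8 + norm c * (3 / 8)"
    using F1 by (intro add_mono mult_left_mono) auto
  finally have "norm c < 1" by simp
  then show ?thesis by (auto simp: c_def)
qed

text \<open>Scale to norm 1. If no spectral value had maximal modulus,
  \<open>1 - \<mu> *\<^sub>C b\<close> would be invertible on the whole closed disc, so some
  \<open>b ^ 2 ^ k\<close> would have norm below 1, contradicting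
  \<open>norm_selfadjoint_power\<close>.\<close>

lemma selfadjoint_norm_attained_in_spectrum:
  fixes a :: "'a::unital_cstar_algebra"
  assumes a: "adj a = a"
  shows "\<exists>z\<in>cstar_spectrum a. cmod z = norm a"
proof (cases "a = 0")
  case True
  then have "0 \<in> cstar_spectrum a"
    by (simp add: cstar_spectrum_iff invertible_el_def)
  with True show ?thesis by auto
next
  case False
  show ?thesis
  proof (rule ccontr)
    assume none: "\<not> ?thesis"
    define r where "r = norm a"
    have r: "r > 0" using False by (simp add: r_def)
    define b where "b = (1 / r) *\<^sub>R a"
    have nb: "norm b = 1" using r by (simp add: b_def flip: r_def)
    have "invertible_el (1 - \<mu> *\<^sub>C b)" if \<mu>: "cmod \<mu> \<le> 1" for \<mu>
    proof (cases "cmod \<mu> < 1")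
      case True
      then show ?thesis
        using nb by (intro invertible_el_1_minus) (simp add: norm_scaleC)
    next
      case False
      with \<mu> have \<mu>: "cmod \<mu> = 1" by simp
      then have "\<mu> \<noteq> 0" by auto
      \<comment> \<open>The point \<open>of_real r / \<mu>\<close> lies on the circle of radius
        \<open>norm a\<close>, which \<open>none\<close> keeps free of spectral values.\<close>
      have "cmod (of_real r / \<mu>) = norm a"
        using \<mu> r by (simp add: norm_divide r_def)
      with none have "invertible_el ((of_real r / \<mu>) *\<^sub>C 1 - a)"
        by (auto simp: cstar_spectrum_iff)
      then have "invertible_el ((\<mu> / of_real r) *\<^sub>C ((of_real r / \<mu>) *\<^sub>C 1 - a))"
        using \<open>\<mu> \<noteq> 0\<close> r by (intro invertible_el_scaleC) auto
      also have "\<dots> = (\<mu> / of_real r * (of_real r / \<mu>)) *\<^sub>C 1 - (\<mu> * of_real (1 / r)) *\<^sub>C a"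
        by (simp add: scaleC_diff scaleC_scaleC)
      also have "\<mu> / of_real r * (of_real r / \<mu>) = 1"
        using \<open>\<mu> \<noteq> 0\<close> r by simp
      also have "1 *\<^sub>C 1 - (\<mu> * of_real (1 / r)) *\<^sub>C a = 1 - \<mu> *\<^sub>C b"
        unfolding b_def scaleC_of_real[symmetric] scaleC_scaleC by simp
      finally show ?thesis .
    qed
    then obtain k where "norm (b ^ 2 ^ k) < 1"
      using exists_power_norm_less_1[of b] nb by auto
    moreover have "adj b = b" using a by (simp add: b_def adj_scaleR)
    ultimately show False
      by (simp add: norm_selfadjoint_power nb)
  qed
qed

section \<open>The positive cone\<close>

lemma cstar_pos_selfadjoint: "a \<in> cstar_pos \<Longrightarrow> adj a = a"
  by (simp add: cstar_pos_def)

text \<open>The spectrum of \<open>a\<close> is real and lies in [-t, t]; it is nonnegative iff the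
  spectrum of t - a lies within distance t of 0, and the norm of t - a is attained there. Positivity
  thus becomes a norm inequality, suited to sums and limits.\<close>

lemma cstar_pos_iff_norm:
  fixes a :: "'a::unital_cstar_algebra"
  assumes a: "adj a = a" and t: "norm a \<le> t"
  shows "a \<in> cstar_pos \<longleftrightarrow> norm (of_real t - a) \<le> t"
proof
  assume pos: "a \<in> cstar_pos"
  have "adj (of_real t - a) = of_real t - a" using a by (simp add: adj_diff)
  then obtain z where z: "z \<in> cstar_spectrum (of_real t - a)" "cmod z = norm (of_real t - a)"
    using selfadjoint_norm_attained_in_spectrum by blast
  define w where "w = of_real t - z"
  have w: "w \<in> cstar_spectrum a"
    using z(1) by (simp add: w_def cstar_spectrum_of_real_minus)
  then have "w \<in> \<real>\<^sub>\<ge>\<^sub>0" using pos by (auto simp: cstar_pos_def)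
  then obtain r where r: "w = of_real r" "r \<ge> 0" by (auto elim: nonneg_Reals_cases)
  have "cmod w \<le> t"
    using cstar_spectrum_norm[OF w] t by linarith
  moreover have "cmod z = \<bar>t - r\<bar>"
    using r(1) by (metis diff_diff_eq2 add_diff_cancel_left' w_def norm_of_real of_real_diff)
  ultimately show "norm (of_real t - a) \<le> t"
    using r z(2) by simp
next
  assume le: "norm (of_real t - a) \<le> t"
  have "z \<in> \<real>\<^sub>\<ge>\<^sub>0" if z: "z \<in> cstar_spectrum a" for z
  proof -
    have "of_real t - z \<in> cstar_spectrum (of_real t - a)"
      using z by (simp add: cstar_spectrum_of_real_minus)
    from cstar_spectrum_norm[OF this] le have "cmod (of_real t - z) \<le> t" by linarith
    then have "t - Re z \<le> t"
      using complex_Re_le_cmod[of "of_real t - z"] by simp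
    then show ?thesis
      using cstar_spectrum_selfadjoint_real[OF a z] by (simp add: complex_nonneg_Reals_iff)
  qed
  with a show "a \<in> cstar_pos" by (auto simp: cstar_pos_def)
qed

text \<open>If \<open>norm a\<close> exceeds \<open>t\<close>, raising \<open>t\<close> to
  \<open>norm a\<close> increases the left side by at most the same amount, so
  \<open>cstar_pos_iff_norm\<close> applies.\<close>

lemma cstar_posI_norm:
  fixes a :: "'a::unital_cstar_algebra"
  assumes a: "adj a = a" and le: "norm (of_real t - a) \<le> t"
  shows "a \<in> cstar_pos"
proof -
  let ?s = "max t (norm a)"
  have "norm (of_real ?s - a) = norm ((of_real t - a) + of_real (?s - t))"
    by simp
  also have "\<dots> \<le> norm (of_real t - a) + norm (of_real (?s - t) :: 'a)"
    by (rule norm_triangle_ineq)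
  also have "\<dots> \<le> ?s"
    using le unfolding norm_of_real by simp
  finally show ?thesis
    using cstar_pos_iff_norm[OF a, of ?s] by simp
qed

text \<open>By the triangle inequality, the norm criteria for the summands add up to the one for the
  sum.\<close>

lemma cstar_pos_add:
  fixes a b :: "'a::unital_cstar_algebra"
  assumes a: "a \<in> cstar_pos" and b: "b \<in> cstar_pos"
  shows "a + b \<in> cstar_pos"
proof (rule cstar_posI_norm)
  show "adj (a + b) = a + b"
    using a b by (simp add: adj_add cstar_pos_selfadjoint)
  have "norm (of_real (norm a) - a) \<le> norm a" "norm (of_real (norm b) - b) \<le> norm b"
    using a b cstar_pos_iff_norm by (auto dest: cstar_pos_selfadjoint)
  then show "norm (of_real (norm a + norm b) - (a + b)) \<le> norm a + norm b"
    using norm_triangle_ineq[of "of_real (norm a) - a" "of_real (norm b) - b"]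
    by (simp add: algebra_simps)
qed

text \<open>At \<open>t = norm a\<close> the norm criterion compares two continuous functions of
  \<open>a\<close>, and the adjoint is continuous.\<close>

lemma closed_cstar_pos: "closed (cstar_pos :: 'a::unital_cstar_algebra set)"
  unfolding closed_sequential_limits
proof (intro allI impI, elim conjE)
  fix s :: "nat \<Rightarrow> 'a" and l
  assume pos: "\<forall>n. s n \<in> cstar_pos" and lim: "s \<longlonglongrightarrow> l"
  then have sa: "\<And>n. adj (s n) = s n" by (simp add: cstar_pos_selfadjoint)
  have "(\<lambda>n. adj (s n)) \<longlonglongrightarrow> adj l"
    by (rule bounded_linear.tendsto[OF bounded_linear_adj lim])
  with lim sa have l: "adj l = l" by (simp add: LIMSEQ_unique)
  have "norm (of_real (norm l) - l) \<le> norm l"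
  proof (rule LIMSEQ_le)
    show "(\<lambda>n. norm (of_real (norm (s n)) - s n)) \<longlonglongrightarrow> norm (of_real (norm l) - l)"
      by (intro tendsto_intros lim)
    show "(\<lambda>n. norm (s n)) \<longlonglongrightarrow> norm l" by (intro tendsto_intros lim)
    show "\<exists>N. \<forall>n\<ge>N. norm (of_real (norm (s n)) - s n) \<le> norm (s n)"
      using pos sa cstar_pos_iff_norm by blast
  qed
  then show "l \<in> cstar_pos" using l by (intro cstar_posI_norm)
qed

lemma cstar_le_of_real_norm:
  fixes a :: "'a::unital_cstar_algebra"
  assumes a: "adj a = a"
  shows "a \<preceq> of_real (norm a)"
  unfolding cstar_le_def
  by (rule cstar_posI_norm[where t = "norm a"]) (auto simp: a adj_diff)

lemma cstar_le_trans: "a \<preceq> b \<Longrightarrow> b \<preceq> c \<Longrightarrow> a \<preceq> c"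
  unfolding cstar_le_def using cstar_pos_add[of "b - a" "c - b"] by simp

text \<open>From \<open>a \<preceq> b\<close> and \<open>b \<preceq> of_real (norm b)\<close>, the
  element norm b - a is positive. Since \<open>norm a\<close> is a spectral value of the positive
  \<open>a\<close>, the number norm b - norm a lies in the spectrum of norm b - a.\<close>

lemma cstar_le_norm_mono:
  fixes a b :: "'a::unital_cstar_algebra"
  assumes a: "a \<in> cstar_pos" and ab: "a \<preceq> b"
  shows "norm a \<le> norm b"
proof -
  have "b = a + (b - a)" by simp
  then have "adj b = b"
    using cstar_pos_add[OF a ab[unfolded cstar_le_def]] by (simp add: cstar_pos_selfadjoint)
  then have "a \<preceq> of_real (norm b)"
    using ab cstar_le_of_real_norm cstar_le_trans by blast
  then have pos: "of_real (norm b) - a \<in> cstar_pos" by (simp add: cstar_le_def)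
  obtain z where z: "z \<in> cstar_spectrum a" "cmod z = norm a"
    using a cstar_pos_selfadjoint selfadjoint_norm_attained_in_spectrum by blast
  have "z \<in> \<real>\<^sub>\<ge>\<^sub>0" using a z by (auto simp: cstar_pos_def)
  then have "z = of_real (norm a)" using z(2) by (auto elim!: nonneg_Reals_cases)
  with z(1) have "of_real (norm b) - of_real (norm a) \<in> cstar_spectrum (of_real (norm b) - a)"
    by (simp add: cstar_spectrum_of_real_minus)
  with pos have "complex_of_real (norm b) - of_real (norm a) \<in> \<real>\<^sub>\<ge>\<^sub>0"
    by (auto simp: cstar_pos_def)
  then show ?thesis by (simp add: complex_nonneg_Reals_iff)
qed

text \<open>With z = w^2, the factorization z - x^2 = (w - x) (w + x) puts \<open>w\<close> or
  \<open>- w\<close> in the spectrum of \<open>x\<close>; so \<open>w\<close> is real and its square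
  nonnegative.\<close>

lemma square_selfadjoint_pos:
  fixes x :: "'a::unital_cstar_algebra"
  assumes x: "adj x = x"
  shows "x * x \<in> cstar_pos"
proof -
  have "z \<in> \<real>\<^sub>\<ge>\<^sub>0" if z: "z \<in> cstar_spectrum (x * x)" for z
  proof -
    define w where "w = csqrt z"
    have w: "z = w * w" by (simp add: w_def flip: power2_eq_square)
    have "z *\<^sub>C 1 - x * x = (w *\<^sub>C 1 - x) * - ((- w) *\<^sub>C 1 - x)"
      unfolding w
      by (simp add: algebra_simps mult_scaleC_left mult_scaleC_right scaleC_scaleC scaleC_diff(2))
    with z have "w \<in> cstar_spectrum x \<or> - w \<in> cstar_spectrum x"
      by (auto simp: cstar_spectrum_iff simp del: minus_diff_eq
          intro: invertible_el_mult invertible_el_minus)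
    then have "Im w = 0"
      using cstar_spectrum_selfadjoint_real[OF x] by fastforce
    then show ?thesis
      unfolding w by (simp add: complex_nonneg_Reals_iff)
  qed
  then show ?thesis using x by (auto simp: cstar_pos_def adj_mult)
qed

section \<open>Square roots and products of positive elements\<close>

lemma norm_gbinomial_half_le_1: "\<bar>(1 / 2 :: real) gchoose k\<bar> \<le> 1"
proof (induction k)
  case (Suc k)
  \<comment> \<open>The ratio of successive coefficients has absolute value at most 1.\<close>
  have "(1 / 2 :: real) gchoose Suc k = (1 / 2 gchoose k) * ((1 / 2 - real k) / (real k + 1))"
    using gbinomial_mult_1[of "1 / 2 :: real" k] by (simp add: field_simps)
  also have "\<bar>\<dots>\<bar> \<le> 1 * 1"
    unfolding abs_mult using Suc.IH by (intro mult_mono) (auto simp: abs_if field_simps)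
  finally show ?case by simp
qed simp

text \<open>The binomial series of \<open>sqrt (1 + x)\<close>; its terms are polynomials in \<open>x\<close>, so
  self-adjointness and commutation pass to the sum.\<close>

lemma exists_selfadjoint_sqrt_1_plus:
  fixes x :: "'a::unital_cstar_algebra"
  assumes x: "adj x = x" and nx: "norm x < 1"
  shows "\<exists>h. adj h = h \<and> h * h = 1 + x \<and> (\<forall>b. b * x = x * b \<longrightarrow> b * h = h * b)"
proof -
  define u where "u k = ((1 / 2) gchoose k) *\<^sub>R x ^ k" for k
  have ub: "norm (u k) \<le> norm x ^ k" for k
  proof -
    have "norm (u k) \<le> 1 * norm x ^ k"
      unfolding u_def norm_scaleR using norm_gbinomial_half_le_1
      by (intro mult_mono norm_power_ineq) auto
    then show ?thesis by simp
  qed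
  have ns: "summable (\<lambda>k. norm (u k))"
    by (rule summable_comparison_test'[of "\<lambda>k. norm x ^ k" 0])
      (use nx ub in \<open>auto intro: summable_geometric\<close>)
  then have s: "summable u" by (rule summable_norm_cancel)
  define h where "h = suminf u"
  have "adj h = (\<Sum>k. adj (u k))"
    unfolding h_def by (rule bounded_linear.suminf[OF bounded_linear_adj s])
  also have "\<dots> = h"
    using x by (simp add: h_def u_def[abs_def] adj_scaleR adj_power)
  finally have adj: "adj h = h" .
  have comm: "b * h = h * b" if "b * x = x * b" for b
  proof -
    have "b * u k = u k * b" for k
      using power_commuting_commutes[of x b k] that by (simp add: u_def)
    then show ?thesis
      unfolding h_def using suminf_mult[OF s, of b] suminf_mult2[OF s, of b] by simp
  qed
  \<comment> \<open>By Vandermonde the Cauchy square has coefficients \<open>1 gchoose k\<close>,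
    which vanish beyond \<open>k = 1\<close>.\<close>
  have "(\<lambda>k. \<Sum>i\<le>k. u i * u (k - i)) sums (h * h)"
    unfolding h_def by (rule Cauchy_product_sums[OF ns ns])
  moreover have "(\<Sum>i\<le>k. u i * u (k - i)) = (1 gchoose k) *\<^sub>R x ^ k" for k
  proof -
    have "(\<Sum>i\<le>k. u i * u (k - i)) = (\<Sum>i\<le>k. ((1 / 2 gchoose i) * (1 / 2 gchoose (k - i)))) *\<^sub>R x ^ k"
      unfolding scaleR_sum_left u_def by (intro sum.cong) (auto simp flip: power_add)
    also have "(\<Sum>i\<le>k. ((1 / 2 :: real) gchoose i) * (1 / 2 gchoose (k - i))) = (1 gchoose k)"
      using gbinomial_Vandermonde[of "1 / 2 :: real" "1 / 2" k] by (simp add: atMost_atLeast0)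
    finally show ?thesis .
  qed
  ultimately have "(\<lambda>k. (1 gchoose k) *\<^sub>R x ^ k) sums (h * h)" by simp
  moreover have "(\<lambda>k. (1 gchoose k) *\<^sub>R x ^ k) sums (\<Sum>k\<in>{0, 1}. (1 gchoose k) *\<^sub>R x ^ k)"
  proof (rule sums_finite)
    show "(1 gchoose k) *\<^sub>R x ^ k = 0" if "k \<notin> {0, 1}" for k
    proof -
      have "1 < k" using that by auto
      then show ?thesis
        using binomial_gbinomial[of 1 k, where 'a = real] by (simp add: binomial_eq_0)
    qed
  qed simp
  ultimately have "h * h = (\<Sum>k\<in>{0, 1}. (1 gchoose k) *\<^sub>R x ^ k)"
    by (rule sums_unique2)
  then have "h * h = 1 + x" by simp
  with adj comm show ?thesis by blast
qed

text \<open>With t = norm a + e, one has a + e = t (1 + x) where x = (a - norm a) / t. The norm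
  criterion bounds the numerator by \<open>norm a\<close>, so the shift by \<open>e\<close> makes
  \<open>norm x\<close> strictly less than 1.\<close>

lemma exists_selfadjoint_sqrt_shift:
  fixes a :: "'a::unital_cstar_algebra"
  assumes a: "a \<in> cstar_pos" and e: "e > 0"
  shows "\<exists>h. adj h = h \<and> h * h = a + of_real e \<and> (\<forall>b. b * a = a * b \<longrightarrow> b * h = h * b)"
proof -
  define t where "t = norm a + e"
  have t: "t > 0" "norm a < t" using e norm_ge_zero[of a] by (auto simp: t_def simp del: norm_ge_zero)
  define x where "x = (1 / t) *\<^sub>R (a - of_real (norm a))"
  have "norm (of_real (norm a) - a) \<le> norm a"
    using a cstar_pos_iff_norm cstar_pos_selfadjoint by blast
  then have "norm x < 1"
    using t by (simp add: x_def norm_minus_commute)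
  moreover have "adj x = x"
    using a by (simp add: x_def adj_scaleR adj_diff cstar_pos_selfadjoint)
  ultimately obtain h where h: "adj h = h" "h * h = 1 + x" "\<And>b. b * x = x * b \<Longrightarrow> b * h = h * b"
    using exists_selfadjoint_sqrt_1_plus by blast
  let ?h = "sqrt t *\<^sub>R h"
  have "?h * ?h = t *\<^sub>R (1 + x)" using h(2) t by simp
  also have "\<dots> = of_real t + (a - of_real (norm a))"
    using t by (simp add: x_def scaleR_add_right of_real_def)
  also have "\<dots> = a + of_real e" by (simp add: t_def)
  finally have "?h * ?h = a + of_real e" .
  moreover have "b * ?h = ?h * b" if "b * a = a * b" for b
  proof -
    have "b * x = x * b" using that by (simp add: x_def algebra_simps of_real_def)
    then show ?thesis using h(3) by simp
  qed
  ultimately show ?thesis using h(1) by (intro exI[of _ ?h]) (auto simp: adj_scaleR)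
qed

text \<open>After a shift by \<open>e\<close> both factors have self-adjoint square roots that
  commute with each other, so the product is the square of a self-adjoint element. Closedness of the
  cone allows \<open>e\<close> to tend to 0.\<close>

lemma cstar_pos_mult:
  fixes a b :: "'a::unital_cstar_algebra"
  assumes a: "a \<in> cstar_pos" and b: "b \<in> cstar_pos" and ab: "a * b = b * a"
  shows "a * b \<in> cstar_pos"
proof -
  define c where "c e = (a + of_real e) * (b + of_real e)" for e :: real
  have "c e \<in> cstar_pos" if e: "e > 0" for e
  proof -
    obtain h where h: "adj h = h" "h * h = a + of_real e" "\<And>y. y * a = a * y \<Longrightarrow> y * h = h * y"
      using exists_selfadjoint_sqrt_shift[OF a e] by blast
    obtain k where k: "adj k = k" "k * k = b + of_real e" "\<And>y. y * b = b * y \<Longrightarrow> y * k = k * y"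
      using exists_selfadjoint_sqrt_shift[OF b e] by blast
    \<comment> \<open>First \<open>h\<close> inherits commutation with \<open>b\<close> from
      \<open>a\<close>; then \<open>k\<close> inherits commutation with \<open>h\<close> from
      \<open>b\<close>.\<close>
    have hk: "h * k = k * h" using h(3)[of b] k(3)[of h] ab by simp
    then have "adj (h * k) = h * k" by (simp add: adj_mult h k)
    then have "(h * k) * (h * k) \<in> cstar_pos" by (rule square_selfadjoint_pos)
    also have "(h * k) * (h * k) = h * (k * h) * k" by (simp add: mult.assoc)
    also have "\<dots> = c e" by (simp add: c_def mult.assoc flip: hk h(2) k(2))
    finally show ?thesis .
  qed
  moreover have "(\<lambda>n. c (inverse (real (Suc n)))) \<longlonglongrightarrow> (a + of_real 0) * (b + of_real 0)"
    unfolding c_def by (intro tendsto_intros LIMSEQ_inverse_real_of_nat)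
  ultimately show ?thesis
    using closed_sequentially[OF closed_cstar_pos, of "\<lambda>n. c (inverse (real (Suc n)))"] by simp
qed

section \<open>Coincidence points\<close>

context cstar_b_metric_space
begin

lemma d_in_cstar_pos: "x \<in> X \<Longrightarrow> y \<in> X \<Longrightarrow> d x y \<in> cstar_pos"
  using d_pos[of x y] by (simp add: cstar_le_def)

text \<open>Taking \<open>z = y\<close> in the triangle inequality shows that \<open>A * d x y\<close> is self-adjoint.\<close>

lemma coeff_commutes_d:
  assumes "x \<in> X" "y \<in> X"
  shows "A * d x y = d x y * A"
proof -
  have "d y y = 0" using d_eq_0_iff[of y y] assms(2) by simp
  then have "A * d x y - d x y \<in> cstar_pos"
    using d_triangle[of x y y] assms by (simp add: cstar_le_def)
  then have "adj (A * d x y) = A * d x y"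
    using cstar_pos_selfadjoint[of "A * d x y - d x y"] cstar_pos_selfadjoint[OF d_in_cstar_pos[OF assms]]
    by (simp add: adj_diff)
  then show ?thesis
    using cstar_pos_selfadjoint[OF coeff_pos] cstar_pos_selfadjoint[OF d_in_cstar_pos[OF assms]]
    by (simp add: adj_mult)
qed

text \<open>B A - B = B (A - 1) is a product of commuting positive elements.\<close>

lemma norm_le_norm_mult_coeff:
  assumes B: "B \<in> cstar_center_pos"
  shows "norm B \<le> norm (B * A)"
proof (rule cstar_le_norm_mono)
  show "B \<in> cstar_pos" using B by (simp add: cstar_center_pos_def)
  have "B * (A - 1) \<in> cstar_pos"
    using B coeff_ge_1 by (intro cstar_pos_mult) (auto simp: cstar_center_pos_def
        cstar_center_def cstar_le_def)
  then show "B \<preceq> B * A" by (simp add: cstar_le_def right_diff_distrib)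
qed

text \<open>Multiplication by \<open>A\<close> preserves \<open>p \<preceq> B * q\<close> because
  \<open>A\<close> commutes with the difference. Centrality of \<open>B\<close> regroups the right
  side as \<open>B * A * q\<close>, keeping \<open>B * A\<close> together under the norm.\<close>

lemma norm_coeff_mult_le:
  assumes B: "B \<in> cstar_center_pos"
    and p: "p \<in> cstar_pos" "A * p = p * A" and q: "A * q = q * A"
    and pq: "p \<preceq> B * q"
  shows "norm (A * p) \<le> norm (B * A) * norm q"
proof -
  have BA: "A * (B * q) = B * A * q" "A * (B * q) = (B * q) * A"
    using B q unfolding cstar_center_pos_def cstar_center_def
    by (auto simp: mult.assoc) (metis mult.assoc)+
  have "norm (A * p) \<le> norm (A * (B * q))"
  proof (rule cstar_le_norm_mono)
    show "A * p \<in> cstar_pos" by (rule cstar_pos_mult[OF coeff_pos p])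
    have "A * (B * q - p) \<in> cstar_pos"
      using pq BA(2) p(2)
      by (intro cstar_pos_mult coeff_pos) (auto simp: cstar_le_def algebra_simps)
    then show "A * p \<preceq> A * (B * q)" by (simp add: cstar_le_def right_diff_distrib)
  qed
  also have "\<dots> \<le> norm (B * A) * norm q"
    unfolding BA(1) by (rule norm_mult_ineq)
  finally show ?thesis .
qed

end

theorem theorem3p5:
  fixes X :: "'x set"
    and d :: "'x \<Rightarrow> 'x \<Rightarrow> 'a::unital_cstar_algebra"
    and A B :: 'a
    and G :: "'x pair_pre_digraph"
    and f g :: "'x \<Rightarrow> 'x"
  assumes space: "cstar_b_metric_space X d A"
    and graph: "pair_wf_digraph G" "pverts G = X" "Id_on X \<subseteq> parcs G"
    and maps: "f \<in> X \<rightarrow> X" "g \<in> X \<rightarrow> X"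
    and B: "B \<in> cstar_center_pos" "norm (B * A) < 1 / 2"
    and contraction: "\<And>x y. x \<in> X \<Longrightarrow> y \<in> X \<Longrightarrow> (g x, g y) \<in> sym_edges G \<Longrightarrow>
        d (f x) (f y) \<preceq> B * (d (f x) (g x) + d (f y) (g y))"
    and range: "f ` X \<subseteq> g ` X"
    and complete: "complete_subspace X d (g ` X)"
    and subseq: "\<And>s x. \<lbrakk>\<And>n. s n \<in> X; x \<in> X; converges_to d (\<lambda>n. g (s n)) x;
          \<And>n. n \<ge> 1 \<Longrightarrow> (g (s n), g (s (n + 1))) \<in> sym_edges G\<rbrakk>
        \<Longrightarrow> \<exists>r :: nat \<Rightarrow> nat. strict_mono r \<and> (\<forall>i\<ge>1. (g (s (r i)), x) \<in> sym_edges G)"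
    and C_nonempty: "C_set X G g f \<noteq> {}"
  shows "PC X f g \<noteq> {} \<and>
    ((\<forall>x\<in>PC X f g. \<forall>y\<in>PC X f g. (x, y) \<in> sym_edges G) \<longrightarrow>
       is_singleton (PC X f g) \<and>
       (weakly_compatible X f g \<longrightarrow> (\<exists>!x. common_fixed_point X f g x)))"
proof -
  interpret cstar_b_metric_space X d A by (rule space)
  define k where "k = norm B"
  define D where "D x = norm (d (f x) (g x))" for x
  have k: "0 \<le> k" "k < 1 / 2"
    using norm_le_norm_mult_coeff[OF B(1)] B(2) by (auto simp: k_def)
  have fX: "f x \<in> X" and gX: "g x \<in> X" if "x \<in> X" for x
    using maps that by auto
  have kannan: "norm (d (f x) (f y)) \<le> k * (D x + D y)"
    if "x \<in> X" "y \<in> X" "(g x, g y) \<in> sym_edges G" for x y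
  proof -
    have "norm (d (f x) (f y)) \<le> norm (B * (d (f x) (g x) + d (f y) (g y)))"
      using that by (intro cstar_le_norm_mono d_in_cstar_pos contraction fX)
    also have "\<dots> \<le> k * norm (d (f x) (g x) + d (f y) (g y))"
      unfolding k_def by (rule norm_mult_ineq)
    also have "\<dots> \<le> k * (D x + D y)"
      using k unfolding D_def by (intro mult_left_mono norm_triangle_ineq)
    finally show ?thesis .
  qed

  \<comment> \<open>Convergence of the iteration\<close>
  obtain s where s: "\<And>n. s n \<in> X" "\<And>n. g (s (Suc n)) = f (s n)"
    "\<And>n m. (g (s n), g (s m)) \<in> sym_edges G"
  proof -
    obtain s :: "nat \<Rightarrow> 'x" where "\<forall>n. s n \<in> X" "\<forall>n\<ge>1. g (s n) = f (s (n - 1))"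
      "\<forall>n m. (g (s n), g (s m)) \<in> sym_edges G"
      using C_nonempty unfolding C_set_def by blast
    then show ?thesis using that[of s] by simp
  qed
  \<comment> \<open>At consecutive points the left side of \<open>kannan\<close> is
    \<open>D (s (Suc n))\<close>; solving D' \<le> k (D' + D) for D' gives this ratio, which is
    below 1 because \<open>k < 1 / 2\<close>.\<close>
  define r where "r = k / (1 - k)"
  have r: "0 \<le> r" "r < 1" using k by (auto simp: r_def field_simps)
  have step: "D (s (Suc n)) \<le> r * D (s n)" for n
  proof -
    have "D (s (Suc n)) \<le> k * (D (s (Suc n)) + D (s n))"
      using kannan[OF s(1) s(1) s(3), of "Suc n" n] by (simp add: D_def s(2))
    then show ?thesis using k by (simp add: r_def field_simps)
  qed
  have decay: "D (s n) \<le> r ^ n * D (s 0)" for n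
  proof (induction n)
    case (Suc n)
    then show ?case
      using step[of n] mult_left_mono[OF Suc.IH r(1)] by (simp add: mult.assoc)
  qed simp
  have geometric: "(\<lambda>n. r ^ n * D (s 0)) \<longlonglongrightarrow> 0"
    using r by (intro tendsto_mult_left_zero LIMSEQ_power_zero) auto
  have D0: "(\<lambda>n. D (s n)) \<longlonglongrightarrow> 0"
    by (rule Lim_null_comparison[OF _ geometric]) (use decay in \<open>simp add: D_def\<close>)

  have "cauchy_seq d (\<lambda>n. g (s n))"
    unfolding cauchy_seq_def
  proof (intro allI impI)
    fix e :: real assume "e > 0"
    then obtain N where N: "\<And>n. n \<ge> N \<Longrightarrow> D (s n) < e"
      using order_tendstoD(2)[OF D0] by (auto simp: eventually_sequentially)
    have "norm (d (g (s n)) (g (s m))) \<le> e" if nm: "n \<ge> Suc N" "m \<ge> Suc N" for n m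
    proof -
      \<comment> \<open>The indices drop by one because \<open>g (s (Suc n))\<close> is
        \<open>f (s n)\<close>, the form to which \<open>kannan\<close> applies.\<close>
      obtain n' m' where n': "n = Suc n'" "m = Suc m'" "n' \<ge> N" "m' \<ge> N"
        using nm by (metis Suc_le_D Suc_le_mono)
      have "norm (d (g (s n)) (g (s m))) \<le> k * (D (s n') + D (s m'))"
        unfolding n' s(2) by (rule kannan) (rule s)+
      also have "\<dots> \<le> (1 / 2) * (e + e)"
        using k N[of n'] N[of m'] n' by (intro mult_mono) (auto simp: D_def)
      finally show ?thesis by simp
    qed
    then show "\<exists>N. \<forall>n\<ge>N. \<forall>m\<ge>N. norm (d (g (s n)) (g (s m))) \<le> e" by blast
  qed

  \<comment> \<open>The limit as a point of coincidence\<close>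
  then obtain t where t: "t \<in> X" and lim: "converges_to d (\<lambda>n. g (s n)) (g t)"
    using complete s(1) unfolding complete_subspace_def by (smt (verit) imageE imageI)
  obtain \<rho> :: "nat \<Rightarrow> nat" where \<rho>: "strict_mono \<rho>" "\<And>i. i \<ge> 1 \<Longrightarrow> (g (s (\<rho> i)), g t) \<in> sym_edges G"
    using subseq[OF s(1) gX[OF t] lim s(3)] by blast
  define c where "c n = norm (d (g (s n)) (g t))" for n
  define q where "q = norm (B * A)"
  have bound: "D t \<le> q * (D (s (\<rho> i)) + D t) + norm A * c (Suc (\<rho> i))" if "i \<ge> 1" for i
  proof -
    let ?x = "s (\<rho> i)"
    let ?p = "d (f t) (f ?x)" and ?v = "d (f ?x) (g t)" and ?q = "d (f ?x) (g ?x) + d (f t) (g t)"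
    have X: "f ?x \<in> X" "g ?x \<in> X" "f t \<in> X" "g t \<in> X" using s(1) t by (auto intro: fX gX)
    have "?p = d (f ?x) (f t)" using X by (intro d_sym)
    then have "?p \<preceq> B * ?q"
      using contraction[OF s(1) t \<rho>(2)[OF that]] by simp
    then have p: "norm (A * ?p) \<le> q * norm ?q"
      unfolding q_def using X
      by (intro norm_coeff_mult_le B d_in_cstar_pos coeff_commutes_d)
        (auto simp: distrib_left distrib_right coeff_commutes_d)
    \<comment> \<open>The triangle inequality goes through \<open>f ?x\<close>, which is the next
      term \<open>g (s (Suc (\<rho> i)))\<close>; its distance to \<open>g t\<close> is
      \<open>c (Suc (\<rho> i))\<close>.\<close>
    have "D t \<le> norm (A * (?p + ?v))"
      unfolding D_def using X by (intro cstar_le_norm_mono d_in_cstar_pos d_triangle)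
    also have "\<dots> \<le> norm (A * ?p) + norm (A * ?v)"
      unfolding distrib_left by (rule norm_triangle_ineq)
    also have "\<dots> \<le> q * norm ?q + norm A * norm ?v"
      by (intro add_mono p norm_mult_ineq)
    also have "\<dots> \<le> q * (D ?x + D t) + norm A * c (Suc (\<rho> i))"
      unfolding D_def c_def s(2) by (intro add_mono mult_left_mono norm_triangle_ineq) (auto simp: q_def)
    finally show ?thesis .
  qed
  \<comment> \<open>In the limit \<open>D t \<le> q * D t\<close> with \<open>q < 1 / 2\<close>, so
    \<open>D t\<close> vanishes.\<close>
  have "D t \<le> q * (0 + D t) + norm A * 0"
  proof (rule LIMSEQ_le_const)
    have "c \<longlonglongrightarrow> 0" using lim by (simp add: converges_to_def c_def[abs_def])
    then have "(\<lambda>i. c (Suc (\<rho> i))) \<longlonglongrightarrow> 0"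
      using LIMSEQ_subseq_LIMSEQ[OF LIMSEQ_Suc \<rho>(1)] by (auto simp: o_def)
    moreover have "(\<lambda>i. D (s (\<rho> i))) \<longlonglongrightarrow> 0"
      using LIMSEQ_subseq_LIMSEQ[OF D0 \<rho>(1)] by (simp add: o_def)
    ultimately show "(\<lambda>i. q * (D (s (\<rho> i)) + D t) + norm A * c (Suc (\<rho> i)))
        \<longlonglongrightarrow> q * (0 + D t) + norm A * 0"
      by (intro tendsto_intros)
    show "\<exists>N. \<forall>i\<ge>N. D t \<le> q * (D (s (\<rho> i)) + D t) + norm A * c (Suc (\<rho> i))"
      using bound by blast
  qed
  then have "(1 - q) * D t \<le> 0" by (simp add: algebra_simps)
  then have "D t \<le> 0" using B(2) by (simp add: q_def mult_le_0_iff)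
  then have "f t = g t" using d_eq_0_iff fX gX t by (simp add: D_def)
  then have "g t \<in> PC X f g" using t gX by (auto simp: PC_def intro!: bexI[of _ t])
  then have ne: "PC X f g \<noteq> {}" by blast

  \<comment> \<open>Uniqueness and the common fixed point\<close>
  have unique: "x = y" if "x \<in> PC X f g" "y \<in> PC X f g" "(x, y) \<in> sym_edges G" for x y
  proof -
    obtain a b where ab: "a \<in> X" "x = f a" "x = g a" "b \<in> X" "y = f b" "y = g b"
      using \<open>x \<in> _\<close> \<open>y \<in> _\<close> by (auto simp: PC_def)
    \<comment> \<open>At coincidence points the right side of \<open>kannan\<close> is 0.\<close>
    have "D a = 0" "D b = 0"
      using ab d_eq_0_iff fX by (simp_all add: D_def)
    then have "norm (d (f a) (f b)) \<le> 0"
      using kannan[of a b] ab that(3) by simp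
    then show ?thesis using ab d_eq_0_iff fX by auto
  qed
  have "is_singleton (PC X f g) \<and>
      (weakly_compatible X f g \<longrightarrow> (\<exists>!x. common_fixed_point X f g x))"
    if edges: "\<forall>x\<in>PC X f g. \<forall>y\<in>PC X f g. (x, y) \<in> sym_edges G"
  proof (intro conjI impI)
    obtain y where y: "PC X f g = {y}"
      using ne unique edges by blast
    then show "is_singleton (PC X f g)" by (simp add: is_singleton_def)
    assume wc: "weakly_compatible X f g"
    have "y \<in> PC X f g" using y by simp
    then obtain x where x: "x \<in> X" "y = f x" "y = g x" by (auto simp: PC_def)
    then have "y \<in> X" using fX by simp
    \<comment> \<open>Weak compatibility at \<open>x\<close> gives f y = f (g x) = g (f x) = g y, so
      \<open>f y\<close> is itself a point of coincidence and must equal \<open>y\<close>.\<close>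
    have "f y = g y" using wc x by (auto simp: weakly_compatible_def)
    with \<open>y \<in> X\<close> have "f y \<in> PC X f g"
      using gX by (auto simp: PC_def intro!: bexI[of _ y])
    with y have "f y = y" by simp
    show "\<exists>!x. common_fixed_point X f g x"
    proof
      show "common_fixed_point X f g y"
        using \<open>y \<in> X\<close> \<open>f y = y\<close> \<open>f y = g y\<close> by (simp add: common_fixed_point_def)
      fix z assume "common_fixed_point X f g z"
      then have "z \<in> PC X f g" by (auto simp: PC_def common_fixed_point_def)
      with y show "z = y" by simp
    qed
  qed
  with ne show ?thesis by blast
qed

end
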